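(* Let $(X,d_X)$ be a metric space and let $\omega\in\mathcal{D}(X)$. Then $$\lim_{K\to\infty}\ \sum_{\varphi\in\mathcal{M}[K](X)}\mathrm{mn}[K](\omega)(\varphi)\cdot d\big(\omega,\mathrm{flrn}(\varphi)\big)=0,$$ where $d$ is the Kantorovich metric on $\mathcal{D}(X)$ and $K$ ranges over positive natural numbers.
   Context: For a set $X$, $\mathcal{M}[K](X)$ is the set of multisets of size $K$ over $X$: functions $\varphi\colon X\to\mathbb{N}$ with finite support and $\sum_{x}\varphi(x)=K$. $\mathcal{D}(X)$ is the set of finitely supported probability distributions on $X$. For $\varphi\in\mathcal{M}[K](X)$ with $K\geq1$, $\mathrm{flrn}(\varphi)\in\mathcal{D}(X)$ is the normalisation $\mathrm{flrn}(\varphi)(x)=\varphi(x)/K$. Kantorovich metric on $\mathcal{D}(X)$: $d(\omega,\omega')=\min_{\tau}\sum_{x,x'}\tau(x,x')\,d_X(x,x')$, where $\tau$ ranges over the $\tau\in\mathcal{D}(X\times X)$ with first marginal $\omega$ and second marginal $\omega'$. Multinomial: $\mathrm{mn}[K](\omega)\in\mathcal{D}(\mathcal{M}[K](X))$ is given by $\mathrm{mn}[K](\omega)(\varphi)=\frac{K!}{\prod_{x}\varphi(x)!}\prod_{x\in X}\omega(x)^{\varphi(x)}$ (with $0^0=1$); it has finite support, so the sum in the claim is effectively finite. *)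

theory Defs
  imports "HOL-Probability.Probability"
begin

text \<open>
  A finitely supported distribution on \<open>'a\<close> is an \<open>'a pmf\<close> with finite \<^const>\<open>set_pmf\<close>,
  a multiset of size \<open>K\<close> over the whole type is an element of
  \<open>multisets_of_size UNIV K\<close>, and \<open>flrn \<phi>\<close> is \<open>pmf_of_multiset \<phi>\<close>, which is
  unspecified for the empty multiset (the case \<open>K = 0\<close>, irrelevant for a limit in \<open>K\<close>).
\<close>

definition couplings :: "'a pmf \<Rightarrow> 'b pmf \<Rightarrow> ('a \<times> 'b) pmf set" where
  "couplings p q = {t. finite (set_pmf t) \<and> map_pmf fst t = p \<and> map_pmf snd t = q}"

definition transport_cost :: "('a::metric_space \<times> 'a) pmf \<Rightarrow> real" where
  "transport_cost t = (\<Sum>(x, y)\<in>set_pmf t. pmf t (x, y) * dist x y)"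

text \<open>
  For finitely supported arguments the infimum is a minimum, see
  \<open>kantorovich_is_minimum\<close> below.
\<close>

definition kantorovich :: "'a::metric_space pmf \<Rightarrow> 'a pmf \<Rightarrow> real" where
  "kantorovich p q = Inf (transport_cost ` couplings p q)"

text \<open>
  The weight is meant for multisets \<open>\<phi>\<close> of size \<open>K\<close>. Both products over the whole space reduce
  to the support of \<open>\<phi>\<close>, as all remaining factors are \<open>0! = 1\<close> and \<open>\<omega>(x)\<^sup>0 = 1\<close>.
\<close>

definition mn :: "nat \<Rightarrow> 'a pmf \<Rightarrow> 'a multiset \<Rightarrow> real" where
  "mn K \<omega> \<phi> = fact K / (\<Prod>x\<in>set_mset \<phi>. fact (count \<phi> x))
      * (\<Prod>x\<in>set_mset \<phi>. pmf \<omega> x ^ count \<phi> x)"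

lemma mn_eq_0:
  assumes "\<not> set_mset \<phi> \<subseteq> set_pmf \<omega>"
  shows "mn K \<omega> \<phi> = 0"
proof -
  from assms obtain x where "x \<in># \<phi>" "x \<notin> set_pmf \<omega>" by auto
  then have "\<exists>x\<in>set_mset \<phi>. pmf \<omega> x ^ count \<phi> x = 0"
    by (intro bexI[of _ x]) (auto simp: set_pmf_iff)
  then have "(\<Prod>x\<in>set_mset \<phi>. pmf \<omega> x ^ count \<phi> x) = 0"
    by (simp add: prod_zero)
  then show ?thesis by (simp add: mn_def)
qed

text \<open>The sum of the theorem is summable, so the infinite sum is not a junk value.\<close>

lemma finite_support_mn:
  assumes "finite (set_pmf \<omega>)"
  shows "finite {\<phi> \<in> multisets_of_size UNIV K. mn K \<omega> \<phi> \<noteq> 0}"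
proof (rule finite_subset)
  show "{\<phi> \<in> multisets_of_size UNIV K. mn K \<omega> \<phi> \<noteq> 0} \<subseteq> multisets_of_size (set_pmf \<omega>) K"
    using mn_eq_0 by (fastforce simp: multisets_of_size_def)
  show "finite (multisets_of_size (set_pmf \<omega>) K)"
    using assms by (rule finite_multisets_of_size)
qed

lemma infsum_mn_eq_sum:
  fixes f :: "'a multiset \<Rightarrow> real"
  assumes "finite (set_pmf \<omega>)"
  shows "(\<Sum>\<^sub>\<infinity>\<phi>\<in>multisets_of_size UNIV K. mn K \<omega> \<phi> * f \<phi>)
    = (\<Sum>\<phi>\<in>multisets_of_size (set_pmf \<omega>) K. mn K \<omega> \<phi> * f \<phi>)"
proof -
  have "(\<Sum>\<^sub>\<infinity>\<phi>\<in>multisets_of_size UNIV K. mn K \<omega> \<phi> * f \<phi>)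
    = (\<Sum>\<^sub>\<infinity>\<phi>\<in>multisets_of_size (set_pmf \<omega>) K. mn K \<omega> \<phi> * f \<phi>)"
    using mn_eq_0 by (intro infsum_cong_neutral) (fastforce simp: multisets_of_size_def)+
  then show ?thesis
    by (simp add: finite_multisets_of_size assms infsum_finite)
qed

lemma coupling_support:
  assumes "t \<in> couplings p q"
  shows "set_pmf t \<subseteq> set_pmf p \<times> set_pmf q"
  using assms by (force simp: couplings_def)

lemma pmf_fst_eq_sum:
  assumes "set_pmf t \<subseteq> A \<times> B" "finite B"
  shows "pmf (map_pmf fst t) x = (\<Sum>y\<in>B. pmf t (x, y))"
proof -
  have "pmf (map_pmf fst t) x = measure t (fst -` {x})" by (simp add: pmf_map)
  also have "\<dots> = measure t (Pair x ` B)"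
    using assms(1) by (intro measure_eq_AE) (auto simp: AE_measure_pmf_iff)
  also have "\<dots> = (\<Sum>z\<in>Pair x ` B. pmf t z)"
    by (intro measure_measure_pmf_finite) (simp add: assms)
  also have "\<dots> = (\<Sum>y\<in>B. pmf t (x, y))" by (subst sum.reindex) (auto intro: inj_onI)
  finally show ?thesis .
qed

lemma pmf_snd_eq_sum:
  assumes "set_pmf t \<subseteq> A \<times> B" "finite A"
  shows "pmf (map_pmf snd t) y = (\<Sum>x\<in>A. pmf t (x, y))"
proof -
  have "pmf (map_pmf snd t) y = measure t (snd -` {y})" by (simp add: pmf_map)
  also have "\<dots> = measure t ((\<lambda>x. (x, y)) ` A)"
    using assms(1) by (intro measure_eq_AE) (auto simp: AE_measure_pmf_iff)
  also have "\<dots> = (\<Sum>z\<in>(\<lambda>x. (x, y)) ` A. pmf t z)"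
    by (intro measure_measure_pmf_finite) (simp add: assms)
  also have "\<dots> = (\<Sum>x\<in>A. pmf t (x, y))" by (subst sum.reindex) (auto intro: inj_onI)
  finally show ?thesis .
qed

lemma transport_cost_eq_sum:
  assumes "set_pmf t \<subseteq> S" "finite S"
  shows "transport_cost t = (\<Sum>z\<in>S. pmf t z * dist (fst z) (snd z))"
  unfolding transport_cost_def case_prod_unfold
  using assms by (intro sum.mono_neutral_cong_left) (auto simp: set_pmf_iff)

lemma pair_pmf_in_couplings:
  assumes "finite (set_pmf p)" "finite (set_pmf q)"
  shows "pair_pmf p q \<in> couplings p q"
  using assms by (simp add: couplings_def map_fst_pair_pmf map_snd_pair_pmf)

lemma transport_cost_attains_minimum:
  fixes p q :: "'a::metric_space pmf"
  assumes fin: "finite (set_pmf p)" "finite (set_pmf q)"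
  obtains t where "t \<in> couplings p q" "\<And>s. s \<in> couplings p q \<Longrightarrow> transport_cost t \<le> transport_cost s"
proof -
  define A where "A = set_pmf p"
  define B where "B = set_pmf q"
  define S where "S = A \<times> B"
  have finS: "finite A" "finite B" "finite S" using fin by (auto simp: A_def B_def S_def)
  define box :: "('a \<times> 'a \<Rightarrow> real) set"
    where "box = PiE UNIV (\<lambda>z. if z \<in> S then {0..1} else {0})"
  define F where "F = box \<inter> ({f. \<forall>x. (\<Sum>y\<in>B. f (x, y)) = pmf p x}
    \<inter> {f. \<forall>y. (\<Sum>x\<in>A. f (x, y)) = pmf q y})"
  define cost where "cost = (\<lambda>f :: 'a \<times> 'a \<Rightarrow> real. \<Sum>z\<in>S. f z * dist (fst z) (snd z))"
  have "compact box"
  proof -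
    have "compactin (product_topology (\<lambda>_. euclidean) UNIV) box"
      unfolding box_def compactin_PiE by (auto simp: compactin_euclidean_iff)
    then show ?thesis by (simp add: euclidean_product_topology compactin_euclidean_iff)
  qed
  moreover have "closed ({f :: 'a \<times> 'a \<Rightarrow> real. \<forall>x. (\<Sum>y\<in>B. f (x, y)) = pmf p x}
    \<inter> {f. \<forall>y. (\<Sum>x\<in>A. f (x, y)) = pmf q y})"
    by (intro closed_Int closed_Collect_all closed_Collect_eq continuous_on_sum
        continuous_on_const continuous_on_product_coordinates)
  ultimately have "compact F" unfolding F_def by (rule compact_Int_closed)
  have pmf_F: "pmf t \<in> F" "transport_cost t = cost (pmf t)" if "t \<in> couplings p q" for t
  proof -
    have sub: "set_pmf t \<subseteq> A \<times> B"
      using coupling_support[OF that] by (simp add: A_def B_def)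
    have "pmf t \<in> box"
      using sub by (auto simp: box_def S_def set_pmf_iff pmf_le_1)
    moreover have "map_pmf fst t = p" "map_pmf snd t = q"
      using that by (auto simp: couplings_def)
    ultimately show "pmf t \<in> F"
      using pmf_fst_eq_sum[OF sub finS(2)] pmf_snd_eq_sum[OF sub finS(1)]
      by (simp add: F_def)
    show "transport_cost t = cost (pmf t)"
      unfolding cost_def by (rule transport_cost_eq_sum) (use sub finS in \<open>auto simp: S_def\<close>)
  qed
  have "F \<noteq> {}" using pmf_F(1)[OF pair_pmf_in_couplings[OF fin]] by auto
  moreover have "continuous_on F cost"
    unfolding cost_def
    by (intro continuous_on_sum continuous_on_mult continuous_on_const
        continuous_on_product_coordinates[THEN continuous_on_subset]) auto
  ultimately obtain f where f: "f \<in> F" "\<And>g. g \<in> F \<Longrightarrow> cost f \<le> cost g"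
    using continuous_attains_inf[OF \<open>compact F\<close>] by blast
  have box: "f z \<in> (if z \<in> S then {0..1} else {0})" for z
    using f(1) unfolding F_def box_def by blast
  have f0: "f z = 0" if "z \<notin> S" for z using box[of z] that by simp
  have nonneg: "f z \<ge> 0" for z using box[of z] by (auto split: if_splits)
  have "(\<integral>\<^sup>+z. ennreal (f z) \<partial>count_space UNIV) = (\<Sum>z\<in>S. ennreal (f z))"
    by (intro nn_integral_count_space') (auto simp: finS f0)
  also have "\<dots> = ennreal (\<Sum>z\<in>S. f z)" by (simp add: sum_ennreal nonneg)
  also have "(\<Sum>z\<in>S. f z) = (\<Sum>x\<in>A. \<Sum>y\<in>B. f (x, y))"
    by (simp add: S_def sum.cartesian_product)
  also have "\<dots> = (\<Sum>x\<in>A. pmf p x)" using f(1) by (simp add: F_def)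
  also have "\<dots> = 1" using fin by (intro sum_pmf_eq_1) (auto simp: A_def)
  finally have one: "(\<integral>\<^sup>+z. ennreal (f z) \<partial>count_space UNIV) = 1" by simp
  define t where "t = embed_pmf f"
  have pmf_t: "pmf t = f" by (rule ext) (simp add: t_def pmf_embed_pmf[OF nonneg one])
  have sub: "set_pmf t \<subseteq> A \<times> B" using f0 by (force simp: set_pmf_iff pmf_t S_def)
  have "map_pmf fst t = p"
    using f(1) by (intro pmf_eqI) (simp add: pmf_fst_eq_sum[OF sub finS(2)] pmf_t F_def)
  moreover have "map_pmf snd t = q"
    using f(1) by (intro pmf_eqI) (simp add: pmf_snd_eq_sum[OF sub finS(1)] pmf_t F_def)
  moreover have "finite (set_pmf t)" using sub finS by (auto intro: finite_subset)
  ultimately have t: "t \<in> couplings p q" by (simp add: couplings_def)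
  show thesis
  proof (rule that[OF t])
    fix s assume "s \<in> couplings p q"
    then show "transport_cost t \<le> transport_cost s"
      using f(2) pmf_F t by (simp add: pmf_t)
  qed
qed

lemma kantorovich_is_minimum:
  fixes p q :: "'a::metric_space pmf"
  assumes "finite (set_pmf p)" "finite (set_pmf q)"
  shows "\<exists>t\<in>couplings p q. kantorovich p q = transport_cost t
    \<and> (\<forall>s\<in>couplings p q. transport_cost t \<le> transport_cost s)"
proof -
  obtain t where t: "t \<in> couplings p q"
    "\<And>s. s \<in> couplings p q \<Longrightarrow> transport_cost t \<le> transport_cost s"
    using transport_cost_attains_minimum[OF assms] by blast
  then have "kantorovich p q = transport_cost t"
    unfolding kantorovich_def by (intro cInf_eq_minimum) auto
  with t show ?thesis by auto
qed

end

theory Submission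
  imports Defs "HOL-Real_Asymp.Real_Asymp"
begin

text \<open>
  If \<open>c \<cdot> p \<le> q\<close> pointwise, then transporting the fraction \<open>c\<close> of the mass of \<open>p\<close> along the
  diagonal and the rest independently shows that the Kantorovich distance is at most \<open>1 - c\<close> times
  the diameter of the supports. For \<open>q = flrn \<phi>\<close> and \<open>p = \<omega>\<close> one can take
  \<open>1 - c \<le> \<Sum>x. \<bar>\<omega> x - \<phi> x / K\<bar> / \<omega> x\<close>, and the variance of the multinomial distribution
  bounds the mean of each summand by a multiple of \<open>1 / \<surd>K\<close>.
\<close>

section \<open>Upper bounds on the Kantorovich distance\<close>

lemma kantorovich_nonneg:
  assumes "finite (set_pmf p)" "finite (set_pmf q)"
  shows "kantorovich p q \<ge> 0"
  using kantorovich_is_minimum[OF assms]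
  by (auto simp: transport_cost_def intro!: sum_nonneg)

lemma kantorovich_le_transport_cost:
  assumes "t \<in> couplings p q" "finite (set_pmf p)" "finite (set_pmf q)"
  shows "kantorovich p q \<le> transport_cost t"
  using kantorovich_is_minimum[OF assms(2,3)] assms(1) by auto

lemma exists_pmf_of_finite_weights:
  fixes f :: "'a \<Rightarrow> real"
  assumes "finite S" "\<And>z. f z \<ge> 0" "\<And>z. z \<notin> S \<Longrightarrow> f z = 0" "(\<Sum>z\<in>S. f z) = 1"
  obtains t where "pmf t = f"
proof
  have "(\<integral>\<^sup>+z. ennreal (f z) \<partial>count_space UNIV) = (\<Sum>z\<in>S. ennreal (f z))"
    using assms by (intro nn_integral_count_space') auto
  also have "\<dots> = 1" using assms by (simp add: sum_ennreal)
  finally show "pmf (embed_pmf f) = f" using assms(2) by (intro ext pmf_embed_pmf) auto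
qed

text \<open>The residual \<open>q - c * p\<close> is nonnegative with total mass
  \<open>1 - c\<close>. Mass kept on the diagonal costs nothing, so only the residual is paid for,
  at a rate of at most \<open>D\<close>.\<close>

lemma kantorovich_le_of_dominated:
  fixes p q :: "'a::metric_space pmf"
  assumes fin: "finite (set_pmf p)" "finite (set_pmf q)"
    and c: "0 \<le> c" "\<And>x. c * pmf p x \<le> pmf q x"
    and D: "\<And>x y. x \<in> set_pmf p \<Longrightarrow> y \<in> set_pmf q \<Longrightarrow> dist x y \<le> D"
  shows "kantorovich p q \<le> (1 - c) * D"
proof -
  \<comment> \<open>Taking the union for \<open>B\<close> keeps the diagonal of the support of
    \<open>p\<close> inside \<open>A \<times> B\<close> without a case split on
    \<open>c = 0\<close>.\<close>
  define A B where "A = set_pmf p" and "B = set_pmf p \<union> set_pmf q"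
  have finAB: "finite A" "finite B" using fin by (auto simp: A_def B_def)
  \<comment> \<open>The diagonal part has both marginals \<open>c * p\<close>; the product part has
    marginals \<open>(1 - c) * p\<close> and \<open>q - c * p\<close>. The residual is not
    normalised, so \<open>c = 1\<close> causes no division by zero.\<close>
  define f where
    "f = (\<lambda>(x, y). (if x = y then c * pmf p x else 0) + pmf p x * (pmf q y - c * pmf p y))"
  have sum_p: "(\<Sum>x\<in>A. pmf p x) = 1" "(\<Sum>x\<in>B. pmf p x) = 1"
    and sum_q: "(\<Sum>x\<in>B. pmf q x) = 1"
    using finAB by (auto simp: A_def B_def intro!: sum_pmf_eq_1)
  have row: "(\<Sum>y\<in>B. f (x, y)) = pmf p x" for x
  proof -
    have "(\<Sum>y\<in>B. if x = y then c * pmf p x else 0) = c * pmf p x"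
      using finAB by (auto simp: B_def set_pmf_iff)
    moreover have "(\<Sum>y\<in>B. pmf p x * (pmf q y - c * pmf p y)) = pmf p x * (1 - c)"
      by (simp add: sum_distrib_left[symmetric] sum_subtractf sum_p sum_q)
    ultimately show ?thesis unfolding f_def by (simp add: sum.distrib) (simp add: algebra_simps)
  qed
  have col: "(\<Sum>x\<in>A. f (x, y)) = pmf q y" for y
  proof -
    have "(\<Sum>x\<in>A. if x = y then c * pmf p x else 0) = c * pmf p y"
      using finAB by (auto simp: A_def set_pmf_iff)
    moreover have "(\<Sum>x\<in>A. pmf p x * (pmf q y - c * pmf p y)) = pmf q y - c * pmf p y"
      by (simp add: sum_distrib_right[symmetric] sum_p)
    ultimately show ?thesis by (simp add: f_def sum.distrib)
  qed
  have f_nonneg: "f z \<ge> 0" for z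
    using c by (auto simp: f_def split: prod.split)
  have f_zero: "f z = 0" if "z \<notin> A \<times> B" for z
    using that by (auto simp: f_def A_def B_def set_pmf_iff split: prod.splits)
  have "(\<Sum>z\<in>A \<times> B. f z) = (\<Sum>x\<in>A. \<Sum>y\<in>B. f (x, y))"
    by (simp add: sum.cartesian_product)
  then have f_sum: "(\<Sum>z\<in>A \<times> B. f z) = 1" by (simp add: row sum_p)
  obtain t where t: "pmf t = f"
    using exists_pmf_of_finite_weights[of "A \<times> B" f] finAB f_nonneg f_zero f_sum by blast
  have sub: "set_pmf t \<subseteq> A \<times> B" using f_zero unfolding set_pmf_eq t by blast
  have "map_pmf fst t = p"
    by (intro pmf_eqI) (simp add: pmf_fst_eq_sum[OF sub finAB(2)] t row)
  moreover have "map_pmf snd t = q"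
    by (intro pmf_eqI) (simp add: pmf_snd_eq_sum[OF sub finAB(1)] t col)
  moreover have "finite (set_pmf t)" using sub finAB by (auto intro: finite_subset)
  ultimately have coupling: "t \<in> couplings p q" by (simp add: couplings_def)
  have D_bound: "pmf p x * (pmf q y - c * pmf p y) * dist x y
      \<le> pmf p x * (pmf q y - c * pmf p y) * D" for x y
  proof (cases "x \<in> set_pmf p \<and> y \<in> set_pmf q")
    case True
    then show ?thesis using c D by (intro mult_left_mono mult_nonneg_nonneg) auto
  next
    \<comment> \<open>Outside the support of \<open>q\<close> the residual vanishes, because
      \<open>0 \<le> c * pmf p y \<le> pmf q y = 0\<close>. Hence \<open>D\<close> need not bound
      distances to all of \<open>B\<close>.\<close>
    case False
    then have "pmf p x = 0 \<or> pmf q y - c * pmf p y = 0"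
      using c(1) c(2)[of y] by (auto simp: set_pmf_iff intro!: antisym mult_nonneg_nonneg)
    then show ?thesis by auto
  qed
  have "transport_cost t = (\<Sum>z\<in>A \<times> B. f z * dist (fst z) (snd z))"
    using transport_cost_eq_sum[OF sub] finAB by (simp add: t)
  also have "\<dots> \<le> (\<Sum>z\<in>A \<times> B. pmf p (fst z) * (pmf q (snd z) - c * pmf p (snd z)) * D)"
  proof (rule sum_mono)
    fix z
    show "f z * dist (fst z) (snd z) \<le> pmf p (fst z) * (pmf q (snd z) - c * pmf p (snd z)) * D"
      \<comment> \<open>The diagonal part of \<open>f\<close> drops out, as it is multiplied by
        \<open>dist x x = 0\<close>.\<close>
      using D_bound[of "fst z" "snd z"] by (cases z) (auto simp: f_def)
  qed
  also have "\<dots> = (\<Sum>x\<in>A. \<Sum>y\<in>B. pmf p x * (pmf q y - c * pmf p y) * D)"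
    by (simp add: sum.cartesian_product case_prod_unfold)
  also have "\<dots> = (\<Sum>x\<in>A. pmf p x) * (\<Sum>y\<in>B. pmf q y - c * pmf p y) * D"
    by (simp only: sum_distrib_left[symmetric] sum_distrib_right[symmetric])
  also have "\<dots> = (1 - c) * D"
    by (simp add: sum_subtractf sum_distrib_left[symmetric] sum_p sum_q)
  finally show ?thesis
    using kantorovich_le_transport_cost[OF coupling fin] by simp
qed

text \<open>If every relative error is at most \<open>s\<close>, then
  \<open>(1 - s) * p \<le> q\<close> pointwise, so domination applies with \<open>c = 1 - s\<close>.
  The sum of the relative errors is such an \<open>s\<close> and, unlike their maximum, is easy to
  average.\<close>

lemma kantorovich_le_sum_relative_error:
  fixes p q :: "'a::metric_space pmf"
  assumes fin: "finite (set_pmf p)" and sub: "set_pmf q \<subseteq> set_pmf p"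
    and D: "\<And>x y. x \<in> set_pmf p \<Longrightarrow> y \<in> set_pmf p \<Longrightarrow> dist x y \<le> D"
  shows "kantorovich p q \<le> D * (\<Sum>x\<in>set_pmf p. \<bar>pmf p x - pmf q x\<bar> / pmf p x)"
proof -
  define s where "s = (\<Sum>x\<in>set_pmf p. \<bar>pmf p x - pmf q x\<bar> / pmf p x)"
  \<comment> \<open>The truncation at 0 covers \<open>s > 1\<close>, and
    \<open>1 - c \<le> s\<close> holds in either case.\<close>
  define c where "c = max 0 (1 - s)"
  have "c * pmf p x \<le> pmf q x" for x
  proof (cases "x \<in> set_pmf p \<and> s \<le> 1")
    case True
    then have pos: "pmf p x > 0" by (simp add: pmf_positive)
    have "\<bar>pmf p x - pmf q x\<bar> / pmf p x \<le> s"
      unfolding s_def using True fin by (intro member_le_sum) auto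
    then have "\<bar>pmf p x - pmf q x\<bar> \<le> s * pmf p x" using pos by (simp add: field_simps)
    then show ?thesis using True by (simp add: c_def algebra_simps)
  next
    case False
    then show ?thesis by (auto simp: c_def set_pmf_iff)
  qed
  moreover have "finite (set_pmf q)" using sub fin by (rule finite_subset)
  ultimately have "kantorovich p q \<le> (1 - c) * D"
    using fin sub D by (intro kantorovich_le_of_dominated) (auto simp: c_def)
  also have "\<dots> \<le> s * D"
  proof (rule mult_right_mono)
    obtain x where "x \<in> set_pmf p" using set_pmf_not_empty by fast
    then show "D \<ge> 0" using D[of x x] by simp
  qed (simp add: c_def)
  finally show ?thesis by (simp add: s_def mult.commute)
qed

section \<open>A recursion for the multinomial weights\<close>

lemma mn_nonneg: "mn K \<omega> \<phi> \<ge> 0"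
  by (simp add: mn_def prod_nonneg)

lemma mn_eq_prod:
  assumes "finite A" "set_mset \<phi> \<subseteq> A"
  shows "mn K \<omega> \<phi> = fact K * (\<Prod>x\<in>A. pmf \<omega> x ^ count \<phi> x / fact (count \<phi> x))"
proof -
  have "mn K \<omega> \<phi> = fact K * (\<Prod>x\<in>set_mset \<phi>. pmf \<omega> x ^ count \<phi> x / fact (count \<phi> x))"
    by (simp add: mn_def prod_dividef)
  also have "(\<Prod>x\<in>set_mset \<phi>. pmf \<omega> x ^ count \<phi> x / fact (count \<phi> x))
      = (\<Prod>x\<in>A. pmf \<omega> x ^ count \<phi> x / fact (count \<phi> x))"
    using assms by (intro prod.mono_neutral_left) (auto simp: not_in_iff)
  finally show ?thesis .
qed

text \<open>Only the factor at \<open>x\<close> and the leading factorial change when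
  \<open>x\<close> is added. The ratio of the weights is cleared of its denominator.\<close>

lemma mn_add_mset:
  "real (Suc (count \<psi> x)) * mn (Suc K) \<omega> (add_mset x \<psi>) = real (Suc K) * pmf \<omega> x * mn K \<omega> \<psi>"
proof -
  define A where "A = set_mset \<psi> - {x}"
  have A: "finite A" "x \<notin> A" by (auto simp: A_def)
  have A_eq: "(\<Prod>y\<in>A. pmf \<omega> y ^ count (add_mset x \<psi>) y / fact (count (add_mset x \<psi>) y))
      = (\<Prod>y\<in>A. pmf \<omega> y ^ count \<psi> y / fact (count \<psi> y))"
    using A by (intro prod.cong) auto
  have mn_Suc: "mn (Suc K) \<omega> (add_mset x \<psi>) = fact (Suc K)
      * (\<Prod>y\<in>insert x A. pmf \<omega> y ^ count (add_mset x \<psi>) y / fact (count (add_mset x \<psi>) y))"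
    by (rule mn_eq_prod) (auto simp: A_def)
  have mn: "mn K \<omega> \<psi> = fact K
      * (\<Prod>y\<in>insert x A. pmf \<omega> y ^ count \<psi> y / fact (count \<psi> y))"
    by (rule mn_eq_prod) (auto simp: A_def)
  show ?thesis
    unfolding mn_Suc mn prod.insert[OF A] A_eq by (simp add: field_simps del: of_nat_Suc)
qed

text \<open>A size-biasing identity: the factor \<open>count \<phi> x\<close> removes the multisets
  without \<open>x\<close>, and the others are uniquely of the form
  \<open>add_mset x \<psi>\<close>. The free \<open>g\<close> lets it yield the total mass and the
  first two moments.\<close>

lemma sum_mn_count_mult:
  assumes x: "x \<in> A" and fin: "finite A"
  shows "(\<Sum>\<phi>\<in>multisets_of_size A (Suc K). mn (Suc K) \<omega> \<phi> * (real (count \<phi> x) * g \<phi>))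
    = real (Suc K) * pmf \<omega> x * (\<Sum>\<psi>\<in>multisets_of_size A K. mn K \<omega> \<psi> * g (add_mset x \<psi>))"
proof -
  have "(\<Sum>\<phi>\<in>multisets_of_size A (Suc K). mn (Suc K) \<omega> \<phi> * (real (count \<phi> x) * g \<phi>))
      = (\<Sum>\<phi>\<in>{\<phi> \<in> multisets_of_size A (Suc K). x \<in># \<phi>}.
          mn (Suc K) \<omega> \<phi> * (real (count \<phi> x) * g \<phi>))"
    using fin
    by (intro sum.mono_neutral_right) (auto simp: finite_multisets_of_size not_in_iff)
  also have "\<dots> = (\<Sum>\<psi>\<in>multisets_of_size A K.
      mn (Suc K) \<omega> (add_mset x \<psi>) * (real (Suc (count \<psi> x)) * g (add_mset x \<psi>)))"
    using x
    by (intro sum.reindex_bij_witness[where i = "add_mset x" and j = "\<lambda>\<phi>. \<phi> - {#x#}"])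
       (auto simp: multisets_of_size_def size_Diff_singleton dest: in_diffD)
  also have "\<dots> = (\<Sum>\<psi>\<in>multisets_of_size A K.
      real (Suc K) * pmf \<omega> x * (mn K \<omega> \<psi> * g (add_mset x \<psi>)))"
  proof (rule sum.cong[OF refl], goal_cases)
    case (1 \<psi>)
    show ?case using arg_cong[OF mn_add_mset[of \<psi> x K \<omega>], of "\<lambda>r. r * g (add_mset x \<psi>)"]
      by (simp only: mult_ac)
  qed
  finally show ?thesis by (simp only: sum_distrib_left)
qed

section \<open>Total mass and moments of the multinomial distribution\<close>

context
  fixes \<omega> :: "'a pmf"
  assumes fin: "finite (set_pmf \<omega>)"
begin

text \<open>The counts of a multiset of size \<open>Suc K\<close> add up to \<open>Suc K\<close>.
  Inserting this sum and size-biasing at each \<open>x\<close> reduces the total mass to that for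
  size \<open>K\<close>.\<close>

lemma sum_mn_eq_1: "(\<Sum>\<phi>\<in>multisets_of_size (set_pmf \<omega>) K. mn K \<omega> \<phi>) = 1"
proof (induction K)
  case 0
  have "multisets_of_size (set_pmf \<omega>) 0 = {{#}}" by (auto simp: multisets_of_size_def)
  then show ?case by (simp add: mn_def)
next
  case (Suc K)
  let ?A = "set_pmf \<omega>"
  have size: "(\<Sum>x\<in>?A. real (count \<phi> x)) = real (Suc K)"
    if "\<phi> \<in> multisets_of_size ?A (Suc K)" for \<phi>
  proof -
    have "(\<Sum>x\<in>?A. count \<phi> x) = size \<phi>"
      unfolding size_multiset_overloaded_eq using that fin
      by (intro sum.mono_neutral_right) (auto simp: multisets_of_size_def not_in_iff)
    then show ?thesis using that
      by (simp add: multisets_of_size_def of_nat_sum[symmetric] del: of_nat_sum of_nat_Suc)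
  qed
  have "real (Suc K) * (\<Sum>\<phi>\<in>multisets_of_size ?A (Suc K). mn (Suc K) \<omega> \<phi>)
      = (\<Sum>\<phi>\<in>multisets_of_size ?A (Suc K). \<Sum>x\<in>?A. mn (Suc K) \<omega> \<phi> * (real (count \<phi> x) * 1))"
    using size by (simp add: sum_distrib_left[symmetric] sum_distrib_right[symmetric]
        mult.commute del: of_nat_Suc)
  also have "\<dots> = (\<Sum>x\<in>?A. \<Sum>\<phi>\<in>multisets_of_size ?A (Suc K).
      mn (Suc K) \<omega> \<phi> * (real (count \<phi> x) * 1))"
    by (rule sum.swap)
  also have "\<dots> = (\<Sum>x\<in>?A. real (Suc K) * pmf \<omega> x)"
    using fin Suc.IH
    by (intro sum.cong refl) (simp add: sum_mn_count_mult[where g = "\<lambda>_. 1", simplified])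
  also have "\<dots> = real (Suc K)"
    using fin by (simp add: sum_distrib_left[symmetric] sum_pmf_eq_1 del: of_nat_Suc)
  finally show ?case by (simp del: of_nat_Suc)
qed

lemma sum_mn_count:
  assumes "x \<in> set_pmf \<omega>"
  shows "(\<Sum>\<phi>\<in>multisets_of_size (set_pmf \<omega>) K. mn K \<omega> \<phi> * real (count \<phi> x)) = real K * pmf \<omega> x"
proof (cases K)
  case 0
  then show ?thesis by (simp add: multisets_of_size_def)
next
  case (Suc k)
  then show ?thesis
    using sum_mn_count_mult[OF assms fin, where g = "\<lambda>_. 1" and K = k and \<omega> = \<omega>]
    by (simp add: sum_mn_eq_1)
qed

text \<open>One factor of the square is used for size-biasing, and the other becomes
  \<open>g\<close>. After adding \<open>x\<close> that factor is \<open>count \<psi> x + 1\<close>,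
  whose mean is \<open>(K - 1) * pmf \<omega> x + 1\<close>.\<close>

lemma sum_mn_count_squared:
  assumes "x \<in> set_pmf \<omega>"
  shows "(\<Sum>\<phi>\<in>multisets_of_size (set_pmf \<omega>) K. mn K \<omega> \<phi> * (real (count \<phi> x))\<^sup>2)
    = real K * pmf \<omega> x * ((real K - 1) * pmf \<omega> x + 1)"
proof (cases K)
  case 0
  then show ?thesis by (simp add: multisets_of_size_def)
next
  case (Suc k)
  have "(\<Sum>\<psi>\<in>multisets_of_size (set_pmf \<omega>) k. mn k \<omega> \<psi> * real (count (add_mset x \<psi>) x))
      = real k * pmf \<omega> x + 1"
    by (simp add: distrib_left sum.distrib sum_mn_count[OF assms] sum_mn_eq_1)
  then show ?thesis
    using sum_mn_count_mult[OF assms fin, where g = "\<lambda>\<phi>. real (count \<phi> x)" and K = k and \<omega> = \<omega>] Suc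
    by (simp add: power2_eq_square)
qed

text \<open>Expanding the square leaves the total mass, the mean and the second moment; the terms
  without a factor \<open>1 / K\<close> cancel.\<close>

lemma variance_mn_frequency:
  assumes "x \<in> set_pmf \<omega>" "K > 0"
  shows "(\<Sum>\<phi>\<in>multisets_of_size (set_pmf \<omega>) K. mn K \<omega> \<phi> * (pmf \<omega> x - real (count \<phi> x) / real K)\<^sup>2)
    = pmf \<omega> x * (1 - pmf \<omega> x) / real K"
proof -
  let ?M = "multisets_of_size (set_pmf \<omega>) K" and ?p = "pmf \<omega> x"
  have "(\<Sum>\<phi>\<in>?M. mn K \<omega> \<phi> * (?p - real (count \<phi> x) / real K)\<^sup>2)
      = (\<Sum>\<phi>\<in>?M. ?p\<^sup>2 * mn K \<omega> \<phi> - 2 * ?p / real K * (mn K \<omega> \<phi> * real (count \<phi> x))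
          + 1 / (real K)\<^sup>2 * (mn K \<omega> \<phi> * (real (count \<phi> x))\<^sup>2))"
    by (intro sum.cong refl) (simp add: power2_diff power_divide algebra_simps)
  also have "\<dots> = ?p\<^sup>2 - 2 * ?p / real K * (real K * ?p)
      + 1 / (real K)\<^sup>2 * (real K * ?p * ((real K - 1) * ?p + 1))"
    by (simp only: sum.distrib sum_subtractf sum_distrib_left[symmetric] sum_mn_eq_1
        sum_mn_count[OF assms(1)] sum_mn_count_squared[OF assms(1)] mult_1_right)
  also have "\<dots> = ?p * (1 - ?p) / real K"
    using assms(2) by (simp add: field_simps power2_eq_square)
  finally show ?thesis .
qed

text \<open>A pointwise quadratic bound on the absolute value takes the place of the Cauchy-Schwarz
  inequality. With scale \<open>sqrt K\<close>, each of its two terms has mean at most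
  \<open>1 / (2 * sqrt K)\<close>.\<close>

lemma mean_mn_frequency_error_le:
  assumes "x \<in> set_pmf \<omega>" "K > 0"
  shows "(\<Sum>\<phi>\<in>multisets_of_size (set_pmf \<omega>) K. mn K \<omega> \<phi> * \<bar>pmf \<omega> x - real (count \<phi> x) / real K\<bar>)
    \<le> 1 / sqrt (real K)"
proof -
  let ?M = "multisets_of_size (set_pmf \<omega>) K" and ?r = "sqrt (real K)"
  define u where "u = (\<lambda>\<phi>. pmf \<omega> x - real (count \<phi> x) / real K)"
  have r: "?r > 0" using assms(2) by simp
  have am_gm: "\<bar>u \<phi>\<bar> \<le> ?r / 2 * (u \<phi>)\<^sup>2 + 1 / (2 * ?r)" for \<phi>
  proof -
    have "0 \<le> (?r * \<bar>u \<phi>\<bar> - 1)\<^sup>2 / (2 * ?r)" using r by simp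
    also have "\<dots> = ?r / 2 * (u \<phi>)\<^sup>2 + 1 / (2 * ?r) - \<bar>u \<phi>\<bar>"
      using r by (simp add: power2_diff power_mult_distrib field_simps power2_eq_square
          del: real_sqrt_mult_self)
    finally show ?thesis by simp
  qed
  have "(\<Sum>\<phi>\<in>?M. mn K \<omega> \<phi> * \<bar>u \<phi>\<bar>)
      \<le> (\<Sum>\<phi>\<in>?M. mn K \<omega> \<phi> * (?r / 2 * (u \<phi>)\<^sup>2 + 1 / (2 * ?r)))"
    by (intro sum_mono mult_left_mono am_gm mn_nonneg)
  also have "\<dots> = (\<Sum>\<phi>\<in>?M. ?r / 2 * (mn K \<omega> \<phi> * (u \<phi>)\<^sup>2) + 1 / (2 * ?r) * mn K \<omega> \<phi>)"
    by (intro sum.cong refl) (simp add: algebra_simps)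
  also have "\<dots> = ?r / 2 * (pmf \<omega> x * (1 - pmf \<omega> x) / real K) + 1 / (2 * ?r)"
    by (simp only: sum.distrib sum_distrib_left[symmetric] u_def
        variance_mn_frequency[OF assms] sum_mn_eq_1 mult_1_right)
  \<comment> \<open>The crude bound \<open>p * (1 - p) \<le> 1\<close> suffices here.\<close>
  also have "\<dots> \<le> ?r / 2 * (1 / real K) + 1 / (2 * ?r)"
    by (intro add_right_mono mult_left_mono divide_right_mono mult_le_one) (auto simp: pmf_le_1)
  also have "\<dots> = 1 / ?r"
    using r assms(2) real_sqrt_mult_self[of "real K"] by (simp add: field_simps)
  finally show ?thesis by (simp add: u_def)
qed

end

section \<open>The mean Kantorovich distance and its limit\<close>

lemma mean_kantorovich_mn_le:
  fixes \<omega> :: "'a::metric_space pmf"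
  assumes fin: "finite (set_pmf \<omega>)" and K: "K > 0"
    and D: "\<And>x y. x \<in> set_pmf \<omega> \<Longrightarrow> y \<in> set_pmf \<omega> \<Longrightarrow> dist x y \<le> D"
  shows "(\<Sum>\<phi>\<in>multisets_of_size (set_pmf \<omega>) K. mn K \<omega> \<phi> * kantorovich \<omega> (pmf_of_multiset \<phi>))
    \<le> D * (\<Sum>x\<in>set_pmf \<omega>. 1 / pmf \<omega> x) * (1 / sqrt (real K))"
proof -
  let ?A = "set_pmf \<omega>" and ?M = "multisets_of_size (set_pmf \<omega>) K"
  define e where "e = (\<lambda>\<phi> x. \<bar>pmf \<omega> x - real (count \<phi> x) / real K\<bar>)"
  obtain z where "z \<in> ?A" using set_pmf_not_empty by fast
  then have D0: "D \<ge> 0" using D[of z z] by simp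
  have le: "kantorovich \<omega> (pmf_of_multiset \<phi>) \<le> D * (\<Sum>x\<in>?A. e \<phi> x / pmf \<omega> x)"
    if "\<phi> \<in> ?M" for \<phi>
  proof -
    \<comment> \<open>Positivity of \<open>K\<close> makes \<open>\<phi>\<close> nonempty, so
      \<open>pmf_of_multiset \<phi>\<close> really has the frequencies
      \<open>count \<phi> x / K\<close> as its weights.\<close>
    have \<phi>: "\<phi> \<noteq> {#}" "size \<phi> = K" "set_mset \<phi> \<subseteq> ?A"
      using that K by (auto simp: multisets_of_size_def)
    then show ?thesis
      using kantorovich_le_sum_relative_error[OF fin, of "pmf_of_multiset \<phi>" D] D
      by (simp add: e_def)
  qed
  have "(\<Sum>\<phi>\<in>?M. mn K \<omega> \<phi> * kantorovich \<omega> (pmf_of_multiset \<phi>))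
      \<le> (\<Sum>\<phi>\<in>?M. mn K \<omega> \<phi> * (D * (\<Sum>x\<in>?A. e \<phi> x / pmf \<omega> x)))"
    by (intro sum_mono mult_left_mono le mn_nonneg)
  \<comment> \<open>Exchanging the two sums isolates the mean error at each single point
    \<open>x\<close>.\<close>
  also have "\<dots> = (\<Sum>\<phi>\<in>?M. \<Sum>x\<in>?A. D / pmf \<omega> x * (mn K \<omega> \<phi> * e \<phi> x))"
    by (simp add: sum_distrib_left mult_ac)
  also have "\<dots> = (\<Sum>x\<in>?A. D / pmf \<omega> x * (\<Sum>\<phi>\<in>?M. mn K \<omega> \<phi> * e \<phi> x))"
    by (subst sum.swap) (simp only: sum_distrib_left)
  also have "\<dots> \<le> (\<Sum>x\<in>?A. D / pmf \<omega> x * (1 / sqrt (real K)))"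
    unfolding e_def using D0
    by (intro sum_mono mult_left_mono mean_mn_frequency_error_le[OF fin _ K]) auto
  also have "\<dots> = D * (\<Sum>x\<in>?A. 1 / pmf \<omega> x) * (1 / sqrt (real K))"
    by (simp add: sum_distrib_left sum_distrib_right sum_divide_distrib)
  finally show ?thesis .
qed

theorem theorem11p2:
  fixes \<omega> :: "'a::metric_space pmf"
  assumes "finite (set_pmf \<omega>)"
  shows "(\<lambda>K. \<Sum>\<^sub>\<infinity>\<phi>\<in>multisets_of_size UNIV K.
            mn K \<omega> \<phi> * kantorovich \<omega> (pmf_of_multiset \<phi>)) \<longlonglongrightarrow> 0"
proof -
  \<comment> \<open>This constant is independent of \<open>K\<close>. The support is finite, hence
    bounded, so its diameter does bound all distances in it.\<close>
  define C where "C = diameter (set_pmf \<omega>) * (\<Sum>x\<in>set_pmf \<omega>. 1 / pmf \<omega> x)"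
  have diam: "dist x y \<le> diameter (set_pmf \<omega>)" if "x \<in> set_pmf \<omega>" "y \<in> set_pmf \<omega>" for x y
    using that assms by (intro diameter_bounded_bound finite_imp_bounded)
  have lim: "(\<lambda>K. C * (1 / sqrt (real K))) \<longlonglongrightarrow> 0"
    by real_asymp
  have le: "\<forall>\<^sub>F K in sequentially. (\<Sum>\<phi>\<in>multisets_of_size (set_pmf \<omega>) K.
      mn K \<omega> \<phi> * kantorovich \<omega> (pmf_of_multiset \<phi>)) \<le> C * (1 / sqrt (real K))"
    \<comment> \<open>Restricting to positive \<open>K\<close> avoids the unspecified
      \<open>pmf_of_multiset {#}\<close>.\<close>
    using eventually_gt_at_top[of 0]
    by eventually_elim (use mean_kantorovich_mn_le[OF assms _ diam] in \<open>simp add: C_def\<close>)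
  have nonneg: "\<forall>\<^sub>F K in sequentially. 0 \<le> (\<Sum>\<phi>\<in>multisets_of_size (set_pmf \<omega>) K.
      mn K \<omega> \<phi> * kantorovich \<omega> (pmf_of_multiset \<phi>))"
    using eventually_gt_at_top[of 0]
  proof eventually_elim
    case (elim K)
    then have "finite (set_pmf (pmf_of_multiset \<phi>))"
      if "\<phi> \<in> multisets_of_size (set_pmf \<omega>) K" for \<phi>
      using that by (subst set_pmf_of_multiset) (auto simp: multisets_of_size_def)
    then show ?case
      using assms by (intro sum_nonneg mult_nonneg_nonneg mn_nonneg kantorovich_nonneg)
  qed
  show ?thesis
    \<comment> \<open>Multisets that leave the support of \<open>\<omega>\<close> have weight 0, so
      the infinite sum is the finite one just bounded.\<close>
    unfolding infsum_mn_eq_sum[OF assms] by (rule tendsto_sandwich[OF nonneg le tendsto_const lim])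
qed

end
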